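(* Suppose we have an algorithm that, given any \textsc{swamp} instance, returns a nonempty set $T$ with $\Gamma(T)\ge\alpha\cdot\max_{\emptyset\ne U}\Gamma(U)$ (an $\alpha$-approximation). Then the algorithm below, using this subroutine, yields an $\frac{\alpha}{\alpha+1}$-approximation for \textsc{card-swamp}: for an instance $H$ and integer $\ell$ (with $\ell\le|V|$) it returns a set $Z$ with $|Z|\ge\ell$ and $\Gamma(Z)\ge\frac{\alpha}{\alpha+1}\max\{\Gamma(U):U\subseteq V,|U|\ge\ell\}$. Consequently, using as subroutine the peeling algorithm below (with bound functions $s_e$ satisfying $0\le s_e(i)\le r_e(i)$ and $r_e(i)-s_e(i-1)\le r_e(i+1)-s_e(i)$), one obtains a $\frac{1}{k+1}$-approximation for \textsc{card-swamp}, where $k$ is the maximum hyperedge size. Cardinality algorithm: set $S\leftarrow\emptyset$, $H_1\leftarrow H$, $i\leftarrow1$. While $|S|<\ell$: let $S_i$ be the (approximate) densest \textsc{swamp} solution in $H_i$ returned by the subroutine; $H_{i+1}\leftarrow\textsc{contract}(H_i,S_i)$; $S\leftarrow S\cup S_i$; $i\leftarrow i+1$. After the loop let $S'$ be $S_1\cup\dots\cup S_{i-2}$ padded with arbitrary nodes so that $|S'|=\ell$. Return whichever of $S$ and $S'$ has the higher density $\Gamma$ (in $H$). Peeling algorithm (for unit weights, weights absorbed into rewards): set $X\leftarrow V$, $Y\leftarrow V$; while $X\ne\emptyset$, choose $v\in\arg\min_{u\in X}\sum_{e\ni u}\big(r_e(|e\cap X|)-s_e(|e\cap X|-1)\big)$,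 set $X\leftarrow X\setminus\{v\}$, and if $\Gamma(X)\ge\Gamma(Y)$ set $Y\leftarrow X$; output $Y$.
   Context: A \textsc{swamp} instance is a hypergraph $H=(V,E,w,\{r_e\})$ with weights $w(e)\ge0$ and rewards $r_e\colon\{0,\dots,|e|\}\to\mathbb{R}_{\ge0}$, monotone nondecreasing with $r_e(0)=0$. For nonempty $S\subseteq V$, $f(S)=\sum_{e\in E}w(e)\,r_e(|e\cap S|)$ and $\Gamma(S)=f(S)/|S|$; \textsc{swamp} maximizes $\Gamma(S)$ over nonempty $S$. \textsc{card-swamp} maximizes $\Gamma(S)$ subject to $|S|\ge\ell$. For a set $U\subseteq V$, $\textsc{contract}(H,U)=(V',E',w',\{r'\})$ has node set $V'=V\setminus U$; each hyperedge $e\in E$ becomes $a=e\setminus U$ with the same weight, and with $j=|e\cap U|$ its reward is $r'_a(i)=r_e(i+j)-r_e(j)$. *)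

theory Defs
  imports Complex_Main "HOL-Library.While_Combinator"
begin

text \<open>
  Hyperedges are abstract indices with a set of end nodes: distinct hyperedges may acquire the
  same (possibly empty) set of end nodes under contraction.
\<close>

record ('v, 'e) swamp =
  nodes  :: "'v set"
  edges  :: "'e set"
  ends   :: "'e \<Rightarrow> 'v set"
  weight :: "'e \<Rightarrow> real"
  reward :: "'e \<Rightarrow> nat \<Rightarrow> real"

definition swamp_instance :: "('v, 'e) swamp \<Rightarrow> bool" where
  "swamp_instance H \<longleftrightarrow>
     finite (nodes H) \<and> finite (edges H) \<and>
     (\<forall>e\<in>edges H.
        ends H e \<subseteq> nodes H \<and>
        0 \<le> weight H e \<and>
        reward H e 0 = 0 \<and>
        (\<forall>i\<in>{0..card (ends H e)}. 0 \<le> reward H e i) \<and>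
        mono_on {0..card (ends H e)} (reward H e))"

definition total_reward :: "('v, 'e) swamp \<Rightarrow> 'v set \<Rightarrow> real" where
  "total_reward H S = (\<Sum>e\<in>edges H. weight H e * reward H e (card (ends H e \<inter> S)))"

text \<open>Only meaningful for nonempty \<open>S\<close>.\<close>

definition density :: "('v, 'e) swamp \<Rightarrow> 'v set \<Rightarrow> real" where
  "density H S = total_reward H S / real (card S)"

definition contract :: "('v, 'e) swamp \<Rightarrow> 'v set \<Rightarrow> ('v, 'e) swamp" where
  "contract H U =
     \<lparr>nodes = nodes H - U,
      edges = edges H,
      ends = (\<lambda>e. ends H e - U),
      weight = weight H,
      reward = (\<lambda>e i. reward H e (i + card (ends H e \<inter> U)) - reward H e (card (ends H e \<inter> U)))\<rparr>"

definition swamp_approx :: "real \<Rightarrow> (('v, 'e) swamp \<Rightarrow> 'v set) \<Rightarrow> bool" where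
  "swamp_approx \<alpha> A \<longleftrightarrow>
     (\<forall>G. swamp_instance G \<and> nodes G \<noteq> {} \<longrightarrow>
        A G \<noteq> {} \<and> A G \<subseteq> nodes G \<and>
        density G (A G) \<ge> \<alpha> * Max (density G ` {U. U \<subseteq> nodes G \<and> U \<noteq> {}}))"

text \<open>
  The loop state is \<open>(G, P, S)\<close>: the current contracted instance, the union of all sets found
  except the last one, and the union of all sets found. The result is \<open>None\<close> iff the loop
  does not terminate.
\<close>

definition card_swamp_loop ::
  "(('v, 'e) swamp \<Rightarrow> 'v set) \<Rightarrow> ('v, 'e) swamp \<Rightarrow> nat
     \<Rightarrow> (('v, 'e) swamp \<times> 'v set \<times> 'v set) option" where
  "card_swamp_loop A H l =
     while_option (\<lambda>(G, P, S). card S < l)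
       (\<lambda>(G, P, S). (contract G (A G), S, S \<union> A G)) (H, {}, {})"

text \<open>
  \<open>Z\<close> is a possible output of the cardinality algorithm; the padding nodes and the choice
  between two sets of equal density are arbitrary.
\<close>

definition card_swamp_output ::
  "(('v, 'e) swamp \<Rightarrow> 'v set) \<Rightarrow> ('v, 'e) swamp \<Rightarrow> nat \<Rightarrow> 'v set \<Rightarrow> bool" where
  "card_swamp_output A H l Z \<longleftrightarrow>
     (\<exists>G P S S'. card_swamp_loop A H l = Some (G, P, S) \<and>
        P \<subseteq> S' \<and> S' \<subseteq> nodes H \<and> card S' = l \<and>
        is_arg_max (density H) (\<lambda>T. T \<in> {S, S'}) Z)"

text \<open>An output exists, and every possible output is feasible and \<open>\<rho>\<close>-approximate.\<close>

definition card_swamp_approx ::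
  "real \<Rightarrow> (('v, 'e) swamp \<Rightarrow> 'v set) \<Rightarrow> ('v, 'e) swamp \<Rightarrow> nat \<Rightarrow> bool" where
  "card_swamp_approx \<rho> A H l \<longleftrightarrow>
     (\<exists>Z. card_swamp_output A H l Z) \<and>
     (\<forall>Z. card_swamp_output A H l Z \<longrightarrow>
        Z \<subseteq> nodes H \<and> l \<le> card Z \<and>
        density H Z \<ge> \<rho> * Max (density H ` {U. U \<subseteq> nodes H \<and> l \<le> card U}))"

definition absorb_weights :: "('v, 'e) swamp \<Rightarrow> ('v, 'e) swamp" where
  "absorb_weights H = H\<lparr>weight := (\<lambda>e. 1), reward := (\<lambda>e i. weight H e * reward H e i)\<rparr>"

definition bound_functions :: "('v, 'e) swamp \<Rightarrow> ('e \<Rightarrow> nat \<Rightarrow> real) \<Rightarrow> bool" where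
  "bound_functions H s \<longleftrightarrow>
     (\<forall>e\<in>edges H.
        (\<forall>i\<in>{0..card (ends H e)}. 0 \<le> s e i \<and> s e i \<le> reward H e i) \<and>
        (\<forall>i\<in>{1..<card (ends H e)}.
           reward H e i - s e (i - 1) \<le> reward H e (i + 1) - s e i))"

definition peel_score ::
  "('v, 'e) swamp \<Rightarrow> ('e \<Rightarrow> nat \<Rightarrow> real) \<Rightarrow> 'v set \<Rightarrow> 'v \<Rightarrow> real" where
  "peel_score H s X u =
     (\<Sum>e | e \<in> edges H \<and> u \<in> ends H e.
        reward H e (card (ends H e \<inter> X)) - s e (card (ends H e \<inter> X) - 1))"

text \<open>
  One iteration of the peeling loop on the state \<open>(X, Y)\<close>. As the density of the empty set is
  undefined, \<open>Y\<close> is never replaced by the empty set.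
\<close>

inductive peel_step ::
  "('v, 'e) swamp \<Rightarrow> ('e \<Rightarrow> nat \<Rightarrow> real) \<Rightarrow> 'v set \<times> 'v set \<Rightarrow> 'v set \<times> 'v set \<Rightarrow> bool"
  for H :: "('v, 'e) swamp" and s :: "'e \<Rightarrow> nat \<Rightarrow> real" where
  "is_arg_min (peel_score H s X) (\<lambda>u. u \<in> X) v \<Longrightarrow> X' = X - {v} \<Longrightarrow>
   Y' = (if X' \<noteq> {} \<and> density H X' \<ge> density H Y then X' else Y) \<Longrightarrow>
   peel_step H s (X, Y) (X', Y')"

definition peeling_output ::
  "('v, 'e) swamp \<Rightarrow> ('e \<Rightarrow> nat \<Rightarrow> real) \<Rightarrow> 'v set \<Rightarrow> bool" where
  "peeling_output H s Y \<longleftrightarrow> (peel_step H s)\<^sup>*\<^sup>* (nodes H, nodes H) ({}, Y)"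

text \<open>Equal to \<open>0\<close> if there are no hyperedges.\<close>

definition max_edge_size :: "('v, 'e) swamp \<Rightarrow> nat" where
  "max_edge_size H = Max (insert 0 ((\<lambda>e. card (ends H e)) ` edges H))"

end

theory Submission
  imports Defs
begin

text \<open>
  Write \<open>c\<close> for the inverse of the subroutine's guarantee and let \<open>U\<close> be an optimal set with
  \<open>|U| \<ge> l\<close>; \<open>P\<close> is the union of all sets found except the last one. If
  \<open>f(U) \<le> (c + 1) f(P)\<close>, then the padded set \<open>S'\<close> of size \<open>l \<le> |U|\<close> is good enough. Otherwise, by
  monotonicity, before every round \<open>U\<close> still gains at least \<open>f(U) - f(P) > c / (c + 1) f(U)\<close> in
  the contracted instance, so every round adds nodes at average gain at least
  \<open>\<Gamma>(U) / (c + 1)\<close>, and \<open>S\<close> is good enough.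

  For peeling, let \<open>U\<close> be a densest set and \<open>X\<close> the set from which its first node \<open>v\<close> is peeled.
  Optimality of \<open>U\<close> shows that removing \<open>v\<close> from \<open>U\<close> costs at least \<open>\<Gamma>(U)\<close>; the condition on the
  bound functions carries this over to the score of \<open>v\<close> in \<open>X\<close>. As \<open>v\<close> minimises the score,
  \<open>|X| \<Gamma>(U)\<close> is at most the sum of all scores in \<open>X\<close>, which by double counting is at most
  \<open>k f(X)\<close>.
\<close>

section \<open>Rewards and contraction\<close>

lemma swamp_instanceD:
  assumes "swamp_instance H"
  shows "finite (nodes H)" "finite (edges H)"
    and "e \<in> edges H \<Longrightarrow> ends H e \<subseteq> nodes H"
    and "e \<in> edges H \<Longrightarrow> finite (ends H e)"
    and "e \<in> edges H \<Longrightarrow> 0 \<le> weight H e"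
    and "e \<in> edges H \<Longrightarrow> reward H e 0 = 0"
    and "e \<in> edges H \<Longrightarrow> i \<le> card (ends H e) \<Longrightarrow> 0 \<le> reward H e i"
    and "e \<in> edges H \<Longrightarrow> i \<le> j \<Longrightarrow> j \<le> card (ends H e) \<Longrightarrow> reward H e i \<le> reward H e j"
  using assms by (auto simp: swamp_instance_def mono_on_def dest: finite_subset)

lemma total_reward_empty: "swamp_instance H \<Longrightarrow> total_reward H {} = 0"
  by (simp add: total_reward_def swamp_instanceD)

lemma total_reward_mono:
  assumes "swamp_instance H" "S \<subseteq> T"
  shows "total_reward H S \<le> total_reward H T"
  unfolding total_reward_def
proof (rule sum_mono)
  fix e assume e: "e \<in> edges H"
  note [simp] = swamp_instanceD(4)[OF assms(1) e]
  have "card (ends H e \<inter> S) \<le> card (ends H e \<inter> T)" "card (ends H e \<inter> T) \<le> card (ends H e)"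
    using assms(2) by (auto intro!: card_mono)
  then show "weight H e * reward H e (card (ends H e \<inter> S))
      \<le> weight H e * reward H e (card (ends H e \<inter> T))"
    using swamp_instanceD(5,8)[OF assms(1) e] by (simp add: mult_left_mono)
qed

lemma total_reward_nonneg: "swamp_instance H \<Longrightarrow> 0 \<le> total_reward H S"
  using total_reward_mono[of H "{}" S] total_reward_empty[of H] by simp

lemma density_nonneg: "swamp_instance H \<Longrightarrow> 0 \<le> density H S"
  by (simp add: density_def total_reward_nonneg)

lemma nodes_contract [simp]: "nodes (contract H U) = nodes H - U"
  by (simp add: contract_def)

text \<open>A hyperedge meets \<open>U \<union> T\<close> in two disjoint parts, so the shift in the
  contracted reward accounts for the nodes already in \<open>U\<close>, and the subtracted constants
  add up to \<open>total_reward H U\<close>.\<close>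

lemma total_reward_contract:
  assumes "swamp_instance H" "T \<inter> U = {}"
  shows "total_reward (contract H U) T = total_reward H (U \<union> T) - total_reward H U"
proof -
  have "card ((ends H e - U) \<inter> T) + card (ends H e \<inter> U) = card (ends H e \<inter> (U \<union> T))"
    if e: "e \<in> edges H" for e
  proof -
    have "ends H e \<inter> (U \<union> T) = ((ends H e - U) \<inter> T) \<union> (ends H e \<inter> U)"
      using assms(2) by blast
    moreover have "card \<dots> = card ((ends H e - U) \<inter> T) + card (ends H e \<inter> U)"
      by (rule card_Un_disjoint) (use swamp_instanceD(4)[OF assms(1) e] in auto)
    ultimately show ?thesis by simp
  qed
  then show ?thesis
    by (simp add: total_reward_def contract_def right_diff_distrib sum_subtractf)
qed

lemma swamp_instance_contract:
  assumes "swamp_instance H"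
  shows "swamp_instance (contract H U)"
proof -
  \<comment> \<open>Shifted arguments stay in the range where \<open>reward H e\<close> is known to
    be monotone.\<close>
  have "i + card (ends H e \<inter> U) \<le> card (ends H e)"
    if "e \<in> edges H" "i \<le> card (ends H e - U)" for e i
    using that swamp_instanceD(4)[OF assms that(1)]
    by (metis add.commute add_le_cancel_left card_Int_Diff)
  then show ?thesis
    using swamp_instanceD[OF assms]
    unfolding swamp_instance_def contract_def by (fastforce simp: mono_on_def)
qed

lemma max_edge_size_ge:
  "swamp_instance H \<Longrightarrow> e \<in> edges H \<Longrightarrow> card (ends H e) \<le> max_edge_size H"
  by (simp add: max_edge_size_def swamp_instanceD)

lemma max_edge_size_contract:
  assumes "swamp_instance H"
  shows "max_edge_size (contract H U) \<le> max_edge_size H"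
proof -
  have "card (ends H e - U) \<le> max_edge_size H" if "e \<in> edges H" for e
    using max_edge_size_ge[OF assms that] swamp_instanceD(4)[OF assms that]
    by (meson Diff_subset card_mono le_trans)
  then show ?thesis
    using swamp_instanceD(2)[OF assms]
    unfolding max_edge_size_def[of "contract H U"] by (simp add: contract_def)
qed

section \<open>The cardinality algorithm\<close>

text \<open>The remainder \<open>U - S\<close> competes with \<open>T\<close> in \<open>G\<close>:
  by monotonicity it gains at least \<open>total_reward H U - total_reward H S\<close>, shared by at
  most \<open>card U\<close> nodes. Describing \<open>G\<close> by its gains over \<open>S\<close>
  fits the result of several contractions.\<close>

lemma marginal_density_of_round:
  assumes H: "swamp_instance H"
    and G: "\<And>T. T \<subseteq> nodes H - S \<Longrightarrow> total_reward G T = total_reward H (S \<union> T) - total_reward H S"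
    and S: "finite S" "card S < card U"
    and T: "\<And>W. W \<subseteq> nodes H - S \<Longrightarrow> W \<noteq> {} \<Longrightarrow> density G W \<le> c * density G T" "T \<noteq> {}" "finite T"
    and U: "U \<subseteq> nodes H"
    and c: "0 \<le> c"
    and gain: "(c + 1) * total_reward H S < total_reward H U"
  shows "density H U * real (card T) \<le> (c + 1) * total_reward G T"
proof -
  have finU: "finite U"
    using U H finite_subset swamp_instanceD(1) by blast
  have ne: "U - S \<noteq> {}"
    using S card_mono[of S U] by auto
  have UG: "total_reward G (U - S) \<ge> total_reward H U - total_reward H S"
    using G[OF Diff_mono[OF U order_refl]] total_reward_mono[OF H, of U "S \<union> U"] by simp
  define g where "g = total_reward H U - total_reward H S"
  \<comment> \<open>This is \<open>gain\<close> restated for \<open>g\<close>: subtracting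
    \<open>(c + 1) * total_reward H S\<close> from \<open>(c + 1) * total_reward H U\<close> removes
    less than one copy of \<open>total_reward H U\<close>.\<close>
  have cg: "c * total_reward H U < (c + 1) * g"
    using gain by (simp add: g_def algebra_simps)
  have "c * total_reward H U \<ge> 0"
    using c total_reward_nonneg[OF H] by simp
  with cg c have g0: "0 < g"
    by (smt (verit) mult_nonneg_nonpos)
  have cards: "0 < card (U - S)" "card (U - S) \<le> card U"
    using ne finU by (auto simp: card_gt_0_iff intro: card_mono)
  have "g / card U \<le> g / card (U - S)"
    using cards g0 by (intro divide_left_mono) auto
  also have "\<dots> \<le> density G (U - S)"
    using UG by (simp add: density_def g_def divide_right_mono)
  also have "\<dots> \<le> c * density G T"
    using T(1)[of "U - S"] U ne by blast
  finally have *: "g / card U \<le> c * density G T" .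
  have "0 < g / card U"
    using g0 cards by simp
  \<comment> \<open>The factor \<open>c\<close> is cancelled below; \<open>c = 0\<close> would
    contradict the positive gain.\<close>
  with * c have c0: "0 < c"
    by (cases "c = 0") auto
  have "c * density H U \<le> (c + 1) * (g / card U)"
    using cg cards by (simp add: density_def divide_right_mono)
  also have "\<dots> \<le> (c + 1) * (c * density G T)"
    using * c by (intro mult_left_mono) auto
  finally have "density H U \<le> (c + 1) * density G T"
    using c0 by (simp add: mult.left_commute)
  then show ?thesis
    using T(2,3) by (simp add: density_def field_simps card_gt_0_iff)
qed

text \<open>
  The guarantee is stated with the inverse factor \<open>c\<close> so that instances without nonempty
  hyperedges are covered by \<open>c = 0\<close>. It is only required for instances whose hyperedges are no
  larger than those of \<open>H\<close>, as the guarantee of the peeling algorithm depends on their size.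
\<close>

lemma card_swamp_approx_if_swamp_approx:
  fixes H :: "('v, 'e) swamp" and c :: real
  assumes H: "swamp_instance H" and l: "1 \<le> l" "l \<le> card (nodes H)" and c: "0 \<le> c"
    and A: "\<And>G. swamp_instance G \<Longrightarrow> nodes G \<noteq> {} \<Longrightarrow> max_edge_size G \<le> max_edge_size H \<Longrightarrow>
      A G \<noteq> {} \<and> A G \<subseteq> nodes G \<and>
      (\<forall>U. U \<subseteq> nodes G \<and> U \<noteq> {} \<longrightarrow> density G U \<le> c * density G (A G))"
  shows "card_swamp_approx (1 / (c + 1)) A H l"
proof -
  define f where "f = total_reward H"
  \<comment> \<open>The first disjunct serves the padded set, the second \<open>S\<close> itself.
    Multiplied out by \<open>card S\<close>, the second holds trivially for the empty start and is
    additive over rounds.\<close>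
  define good where "good P S \<longleftrightarrow> (\<forall>U. U \<subseteq> nodes H \<and> l \<le> card U \<longrightarrow>
      f U \<le> (c + 1) * f P \<or> density H U * card S \<le> (c + 1) * f S)" for P S
  \<comment> \<open>Rewards are expressed relative to \<open>H\<close>, so the gains of successive
    rounds telescope; \<open>card P < l\<close> leaves room for padding.\<close>
  define inv where "inv = (\<lambda>(G :: ('v, 'e) swamp, P, S). swamp_instance G \<and> nodes G = nodes H - S \<and>
      S \<subseteq> nodes H \<and> max_edge_size G \<le> max_edge_size H \<and>
      (\<forall>T. T \<subseteq> nodes G \<longrightarrow> total_reward G T = f (S \<union> T) - f S) \<and>
      P \<subseteq> S \<and> card P < l \<and> good P S)"
  define cond where "cond = (\<lambda>(G :: ('v, 'e) swamp, P :: 'v set, S :: 'v set). card S < l)"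
  define step where "step = (\<lambda>(G, P :: 'v set, S). (contract G (A G), S, S \<union> A G))"
  note fin = swamp_instanceD(1)[OF H]
  have f_mono: "f S \<le> f T" if "S \<subseteq> T" for S T
    using total_reward_mono[OF H that] by (simp add: f_def)

  \<comment> \<open>Loop invariant: start and preservation\<close>
  have inv_init: "inv (H, {}, {})"
    using H l by (simp add: inv_def good_def f_def total_reward_empty)
  have inv_step: "inv (step (G, P, S)) \<and> card (nodes (fst (step (G, P, S)))) < card (nodes G)"
    if inv: "inv (G, P, S)" and "cond (G, P, S)" for G P S
  proof -
    have Sl: "card S < l" using that by (simp add: cond_def)
    from inv have G: "swamp_instance G" "nodes G = nodes H - S" "S \<subseteq> nodes H"
        "max_edge_size G \<le> max_edge_size H" "P \<subseteq> S" "good P S"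
      and rew: "\<And>T. T \<subseteq> nodes G \<Longrightarrow> total_reward G T = f (S \<union> T) - f S"
      by (auto simp: inv_def)
    have finS: "finite S" using G(3) fin finite_subset by blast
    have "nodes G \<noteq> {}"
      using Sl l G(2,3) by auto
    note AG = A[OF G(1) this G(4)]
    then have disj: "S \<inter> A G = {}" and sub: "A G \<subseteq> nodes H - S" "A G \<subseteq> nodes H"
      using G(2) by auto
    have finA: "finite (A G)" using sub fin finite_subset by blast
    have cardU: "card (S \<union> A G) = card S + card (A G)"
      using disj finS finA by (rule card_Un_disjoint[rotated 2])
    \<comment> \<open>Two successive contractions act like a single one by the union: the
      intermediate \<open>f S\<close> cancels.\<close>
    have rew': "total_reward (contract G (A G)) T = f (S \<union> A G \<union> T) - f (S \<union> A G)"
      if T: "T \<subseteq> nodes H - (S \<union> A G)" for T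
    proof -
      have "total_reward (contract G (A G)) T = total_reward G (A G \<union> T) - total_reward G (A G)"
        using T by (intro total_reward_contract[OF G(1)]) auto
      also have "\<dots> = f (S \<union> (A G \<union> T)) - f (S \<union> A G)"
        using T sub G(2) by (subst (1 2) rew) auto
      finally show ?thesis by (simp add: Un_assoc)
    qed
    have "good S (S \<union> A G)"
      unfolding good_def
    proof (intro allI impI)
      fix U assume U: "U \<subseteq> nodes H \<and> l \<le> card U"
      show "f U \<le> (c + 1) * f S \<or> density H U * card (S \<union> A G) \<le> (c + 1) * f (S \<union> A G)"
      proof (cases "f U \<le> (c + 1) * f S")
        case False
        then have gain: "(c + 1) * f S < f U" by simp
        \<comment> \<open>Since \<open>P \<subseteq> S\<close>, failure of the first disjunct for
          \<open>S\<close> implies its failure for \<open>P\<close>, so the invariant supplies the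
          second disjunct for the earlier rounds.\<close>
        have "(c + 1) * f P \<le> (c + 1) * f S"
          using f_mono[OF G(5)] c by (simp add: mult_left_mono)
        with gain have "\<not> f U \<le> (c + 1) * f P" by linarith
        then have "density H U * card S \<le> (c + 1) * f S"
          using G(6) U unfolding good_def by blast
        moreover have "density H U * card (A G) \<le> (c + 1) * total_reward G (A G)"
          using U Sl AG G(2) rew gain c finS finA unfolding f_def
          by (intro marginal_density_of_round[OF H, where S = S]) auto
        moreover have "total_reward G (A G) = f (S \<union> A G) - f S"
          using AG rew by blast
        ultimately have "density H U * card (S \<union> A G) \<le> (c + 1) * f (S \<union> A G)"
          by (simp add: cardU algebra_simps)
        then show ?thesis ..
      qed simp
    qed
    moreover have "nodes H - S - A G = nodes H - (S \<union> A G)" by blast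
    ultimately have "inv (step (G, P, S))"
      using G sub Sl rew' swamp_instance_contract[OF G(1)]
        max_edge_size_contract[OF G(1), of "A G"]
      by (simp add: inv_def step_def)
    moreover have "nodes G - A G \<subset> nodes G"
      using AG by blast
    then have "card (nodes G - A G) < card (nodes G)"
      using swamp_instanceD(1)[OF G(1)] psubset_card_mono by blast
    ultimately show ?thesis
      by (simp add: step_def)
  qed

  \<comment> \<open>Termination and the final state\<close>
  have loop: "card_swamp_loop A H l = while_option cond step (H, {}, {})"
    by (simp add: card_swamp_loop_def cond_def step_def)
  \<comment> \<open>Every round removes a nonempty set, so the number of remaining nodes
    decreases.\<close>
  have "\<exists>t. while_option cond step (H, {}, {}) = Some t"
    by (rule measure_while_option_Some[where P = inv and f = "\<lambda>t. card (nodes (fst t))"])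
      (use inv_init inv_step in auto)
  then obtain G P S where run: "card_swamp_loop A H l = Some (G, P, S)"
    using loop by (metis prod_cases3)
  have "inv (G, P, S)"
    by (rule while_option_rule[of inv cond step]) (use run loop inv_init inv_step in auto)
  then have S: "S \<subseteq> nodes H" "P \<subseteq> S" "card P < l" "good P S"
    by (auto simp: inv_def)
  have "\<not> cond (G, P, S)"
    using while_option_stop run loop by metis
  then have lS: "l \<le> card S" by (simp add: cond_def)

  \<comment> \<open>Existence and quality of the output\<close>
  have ex: "\<exists>Z. card_swamp_output A H l Z"
  proof -
    obtain S' where S': "P \<subseteq> S'" "S' \<subseteq> nodes H" "card S' = l"
      using exists_subset_between[of P l "nodes H"] S l fin by auto
    have "is_arg_max (density H) (\<lambda>T. T \<in> {S, S'})
        (if density H S' \<le> density H S then S else S')"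
      by (auto simp: is_arg_max_linorder)
    then show ?thesis
      using run S' unfolding card_swamp_output_def by blast
  qed
  have "Z \<subseteq> nodes H \<and> l \<le> card Z \<and>
      density H Z \<ge> 1 / (c + 1) * Max (density H ` {U. U \<subseteq> nodes H \<and> l \<le> card U})"
    if out: "card_swamp_output A H l Z" for Z
  proof -
    obtain S' where S': "P \<subseteq> S'" "S' \<subseteq> nodes H" "card S' = l"
      and Z: "is_arg_max (density H) (\<lambda>T. T \<in> {S, S'}) Z"
      using out run unfolding card_swamp_output_def by auto
    have Z2: "Z = S \<or> Z = S'" "density H S \<le> density H Z" "density H S' \<le> density H Z"
      using Z by (auto simp: is_arg_max_linorder)
    have opt: "density H U \<le> (c + 1) * density H Z" if U: "U \<subseteq> nodes H" "l \<le> card U" for U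
    proof -
      consider "f U \<le> (c + 1) * f P" | "density H U * card S \<le> (c + 1) * f S"
        using S(4) U unfolding good_def by blast
      then show ?thesis
      proof cases
        case 1
        \<comment> \<open>As \<open>U\<close> has at least \<open>l\<close> nodes, dividing by
          \<open>l\<close> instead only increases the quotient, and \<open>l\<close> is exactly the
          size of \<open>S'\<close>.\<close>
        have "density H U \<le> f U / l"
          using U l total_reward_nonneg[OF H] unfolding density_def f_def
          by (intro divide_left_mono) auto
        also have "\<dots> \<le> (c + 1) * f S' / l"
          using 1 f_mono[OF S'(1)] c
          by (intro divide_right_mono order_trans[OF 1] mult_left_mono) auto
        also have "\<dots> = (c + 1) * density H S'"
          by (simp add: density_def f_def S')
        also have "\<dots> \<le> (c + 1) * density H Z"
          using Z2 c by (intro mult_left_mono) auto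
        finally show ?thesis .
      next
        case 2
        then have "density H U \<le> (c + 1) * density H S"
          using lS l by (simp add: density_def f_def field_simps)
        also have "\<dots> \<le> (c + 1) * density H Z"
          using Z2 c by (intro mult_left_mono) auto
        finally show ?thesis .
      qed
    qed
    have "Max (density H ` {U. U \<subseteq> nodes H \<and> l \<le> card U}) \<le> (c + 1) * density H Z"
      using fin l opt by (subst Max_le_iff) auto
    then have "density H Z \<ge> 1 / (c + 1) * Max (density H ` {U. U \<subseteq> nodes H \<and> l \<le> card U})"
      using c by (simp add: field_simps)
    then show ?thesis
      using Z2(1) S(1) S' lS by auto
  qed
  with ex show ?thesis
    unfolding card_swamp_approx_def by blast
qed

section \<open>The peeling algorithm\<close>

lemma absorb_weights_simps [simp]:
  "nodes (absorb_weights H) = nodes H"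
  "edges (absorb_weights H) = edges H"
  "ends (absorb_weights H) = ends H"
  "weight (absorb_weights H) = (\<lambda>e. 1)"
  "density (absorb_weights H) = density H"
  "max_edge_size (absorb_weights H) = max_edge_size H"
  by (auto simp: absorb_weights_def density_def total_reward_def max_edge_size_def fun_eq_iff)

lemma swamp_instance_absorb_weights:
  assumes "swamp_instance H"
  shows "swamp_instance (absorb_weights H)"
  using assms
  by (auto simp: swamp_instance_def absorb_weights_def mono_on_def intro!: mult_left_mono)

lemma peel_terminates:
  assumes "finite X"
  shows "\<exists>Y'. (peel_step H s)\<^sup>*\<^sup>* (X, Y) ({}, Y')"
  using assms
proof (induction "card X" arbitrary: X Y)
  case 0
  then show ?case by auto
next
  case (Suc n)
  then have "X \<noteq> {}" by auto
  then obtain v where v: "is_arg_min (peel_score H s X) (\<lambda>u. u \<in> X) v"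
    using ex_is_arg_min_if_finite[OF Suc.prems] by blast
  then have "v \<in> X" by (simp add: is_arg_min_def)
  then have "n = card (X - {v})" using Suc by simp
  with Suc show ?case
    using peel_step.intros[OF v refl refl] converse_rtranclp_into_rtranclp
    by (metis finite_Diff)
qed

context
  fixes H :: "('v, 'e) swamp" and s :: "'e \<Rightarrow> nat \<Rightarrow> real"
  assumes H: "swamp_instance H" and unit: "weight H = (\<lambda>e. 1)" and s: "bound_functions H s"
begin

lemma bound_functionsD:
  assumes "e \<in> edges H"
  shows "i \<le> card (ends H e) \<Longrightarrow> 0 \<le> s e i"
    and "i \<le> card (ends H e) \<Longrightarrow> s e i \<le> reward H e i"
    and "1 \<le> i \<Longrightarrow> i < card (ends H e) \<Longrightarrow>
      reward H e i - s e (i - 1) \<le> reward H e (i + 1) - s e i"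
  using s assms by (auto simp: bound_functions_def)

text \<open>Iterates the one-step condition on bound functions; starting at \<open>1\<close> keeps
  \<open>i - 1\<close> a true predecessor.\<close>

lemma score_term_mono:
  assumes "e \<in> edges H" "1 \<le> i" "i \<le> j" "j \<le> card (ends H e)"
  shows "reward H e i - s e (i - 1) \<le> reward H e j - s e (j - 1)"
  using assms(3,4)
proof (induction rule: dec_induct)
  case (step n)
  then show ?case
    using bound_functionsD(3)[OF assms(1), of n] assms(2) by simp
qed simp

text \<open>With \<open>i\<close> the size of \<open>ends H e \<inter> U\<close>, a hyperedge at
  \<open>v\<close> loses \<open>reward H e i - reward H e (i - 1)\<close>. Replacing the second
  reward by the smaller \<open>s e (i - 1)\<close> gives a score term, which grows as
  \<open>U\<close> is enlarged to \<open>X\<close>.\<close>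

lemma removal_loss_le_peel_score:
  assumes "v \<in> U" "U \<subseteq> X"
  shows "total_reward H U - total_reward H (U - {v}) \<le> peel_score H s X v"
proof -
  let ?E = "{e. e \<in> edges H \<and> v \<in> ends H e}"
  let ?d = "\<lambda>e. reward H e (card (ends H e \<inter> U)) - reward H e (card (ends H e \<inter> (U - {v})))"
  have "total_reward H U - total_reward H (U - {v}) = (\<Sum>e\<in>edges H. ?d e)"
    by (simp add: total_reward_def unit sum_subtractf)
  also have "\<dots> = (\<Sum>e\<in>?E. ?d e)"
  proof (rule sum.mono_neutral_right)
    have "ends H e \<inter> (U - {v}) = ends H e \<inter> U" if "v \<notin> ends H e" for e
      using that by blast
    then show "\<forall>e\<in>edges H - ?E. ?d e = 0" by simp
  qed (use swamp_instanceD[OF H] in auto)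
  also have "\<dots> \<le> peel_score H s X v"
    unfolding peel_score_def
  proof (rule sum_mono)
    fix e assume "e \<in> ?E"
    then have e: "e \<in> edges H" "v \<in> ends H e" by auto
    note [simp] = swamp_instanceD(4)[OF H e(1)]
    have "ends H e \<inter> (U - {v}) = (ends H e \<inter> U) - {v}" by blast
    then have minus: "card (ends H e \<inter> (U - {v})) = card (ends H e \<inter> U) - 1"
      using e assms by simp
    have "card (ends H e \<inter> U) > 0"
      using e assms by (auto simp: card_gt_0_iff)
    moreover have "card (ends H e \<inter> U) \<le> card (ends H e \<inter> X)"
      "card (ends H e \<inter> X) \<le> card (ends H e)"
      using assms by (auto intro!: card_mono)
    ultimately show "?d e \<le>
        reward H e (card (ends H e \<inter> X)) - s e (card (ends H e \<inter> X) - 1)"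
      using score_term_mono[OF e(1), of "card (ends H e \<inter> U)" "card (ends H e \<inter> X)"]
        bound_functionsD(2)[OF e(1), of "card (ends H e \<inter> U) - 1"]
      unfolding minus by linarith
  qed
  finally show ?thesis .
qed

text \<open>Double counting: the term of a hyperedge occurs once for each of its nodes in
  \<open>X\<close>, and dropping the nonnegative \<open>s\<close> leaves its reward.\<close>

lemma sum_peel_score_le:
  assumes "finite X"
  shows "(\<Sum>u\<in>X. peel_score H s X u) \<le> real (max_edge_size H) * total_reward H X"
proof -
  let ?t = "\<lambda>e. reward H e (card (ends H e \<inter> X)) - s e (card (ends H e \<inter> X) - 1)"
  note finE = swamp_instanceD(2)[OF H]
  have "(\<Sum>u\<in>X. peel_score H s X u) = (\<Sum>e\<in>edges H. \<Sum>u | u \<in> X \<and> u \<in> ends H e. ?t e)"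
    unfolding peel_score_def by (rule sum.swap_restrict[OF assms finE])
  also have "\<dots> = (\<Sum>e\<in>edges H. card (ends H e \<inter> X) * ?t e)"
    by (intro sum.cong refl) (auto simp: Int_def conj_commute)
  also have "\<dots> \<le> (\<Sum>e\<in>edges H. max_edge_size H * reward H e (card (ends H e \<inter> X)))"
  proof (rule sum_mono)
    fix e assume e: "e \<in> edges H"
    have le: "card (ends H e \<inter> X) \<le> card (ends H e)"
      using swamp_instanceD(4)[OF H e] by (auto intro: card_mono)
    \<comment> \<open>If \<open>e\<close> misses \<open>X\<close>, the index \<open>0 - 1\<close> is
      \<open>0\<close>, where \<open>s e\<close> is still nonnegative.\<close>
    then have "?t e \<le> reward H e (card (ends H e \<inter> X))"
      using bound_functionsD(1)[OF e, of "card (ends H e \<inter> X) - 1"] by simp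
    then have "card (ends H e \<inter> X) * ?t e
        \<le> card (ends H e \<inter> X) * reward H e (card (ends H e \<inter> X))"
      by (intro mult_left_mono) auto
    also have "\<dots> \<le> max_edge_size H * reward H e (card (ends H e \<inter> X))"
      using le max_edge_size_ge[OF H e] swamp_instanceD(7)[OF H e le]
      by (intro mult_right_mono) auto
    finally show "card (ends H e \<inter> X) * ?t e
        \<le> max_edge_size H * reward H e (card (ends H e \<inter> X))" .
  qed
  also have "\<dots> = max_edge_size H * total_reward H X"
    by (simp add: total_reward_def unit sum_distrib_left)
  finally show ?thesis .
qed

lemma densest_le_density_at_first_removal:
  assumes U: "U \<subseteq> X" and X: "finite X"
    and max: "\<And>W. W \<subseteq> U \<Longrightarrow> W \<noteq> {} \<Longrightarrow> density H W \<le> density H U"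
    and v: "is_arg_min (peel_score H s X) (\<lambda>u. u \<in> X) v" "v \<in> U"
  shows "density H U \<le> real (max_edge_size H) * density H X"
proof -
  have finU: "finite U" using U X finite_subset by blast
  have cardU: "card U > 0" using finU v(2) by (auto simp: card_gt_0_iff)
  \<comment> \<open>This compares \<open>U - {v}\<close> with the densest set; a singleton
    \<open>U\<close> is treated apart, as \<open>max\<close> does not cover the empty set.\<close>
  have "total_reward H (U - {v}) \<le> density H U * card (U - {v})"
  proof (cases "U - {v} = {}")
    case True
    then show ?thesis by (simp only: total_reward_empty[OF H]) simp
  next
    case False
    then have "0 < card (U - {v})" using finU by (simp add: card_gt_0_iff)
    then show ?thesis
      using max[of "U - {v}"] False by (simp add: density_def[of H "U - {v}"] pos_divide_le_eq)
  qed
  moreover have "total_reward H U = density H U * card U"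
    using cardU by (simp add: density_def)
  moreover have "real (card U) = real (card (U - {v})) + 1"
    using v(2) finU cardU by simp
  ultimately have "density H U \<le> total_reward H U - total_reward H (U - {v})"
    by (simp add: algebra_simps)
  also have "\<dots> \<le> peel_score H s X v"
    by (rule removal_loss_le_peel_score[OF v(2) U])
  \<comment> \<open>The bound passes from \<open>v\<close> to all of \<open>X\<close> because
    \<open>v\<close> minimises the score.\<close>
  finally have "density H U \<le> peel_score H s X u" if "u \<in> X" for u
    using v(1) that unfolding is_arg_min_linorder by force
  then have "real (card X) * density H U \<le> (\<Sum>u\<in>X. peel_score H s X u)"
    by (rule sum_bounded_below)
  also have "\<dots> \<le> real (max_edge_size H) * total_reward H X"
    by (rule sum_peel_score_le[OF X])
  finally have *: "real (card X) * density H U \<le> real (max_edge_size H) * total_reward H X" .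
  have "card X > 0"
    using v U X by (auto simp: card_gt_0_iff)
  with * show ?thesis
    by (simp add: density_def[of H X] pos_le_divide_eq mult.commute)
qed

text \<open>Until a node of \<open>U\<close> is peeled, \<open>U \<subseteq> X\<close>. When the
  first one goes, the current \<open>X\<close> is dense enough and \<open>Y\<close> is at least as
  dense; later rounds never lower the density of \<open>Y\<close>.\<close>

lemma peeling_invariant:
  assumes U: "U \<subseteq> nodes H"
    and max: "\<And>W. W \<subseteq> nodes H \<Longrightarrow> W \<noteq> {} \<Longrightarrow> density H W \<le> density H U"
    and ne: "nodes H \<noteq> {}"
    and reach: "(peel_step H s)\<^sup>*\<^sup>* (nodes H, nodes H) (X, Y)"
  shows "X \<subseteq> nodes H \<and> Y \<subseteq> nodes H \<and> Y \<noteq> {} \<and>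
    (X \<noteq> {} \<longrightarrow> density H X \<le> density H Y) \<and>
    (U \<subseteq> X \<or> density H U \<le> real (max_edge_size H) * density H Y)"
  using reach
proof (induction rule: rtranclp_induct2)
  case refl
  then show ?case using U ne by simp
next
  case (step X Y X' Y')
  let ?k = "real (max_edge_size H)"
  from step(2) obtain v where v: "is_arg_min (peel_score H s X) (\<lambda>u. u \<in> X) v"
    and X': "X' = X - {v}"
    and Y': "Y' = (if X' \<noteq> {} \<and> density H X' \<ge> density H Y then X' else Y)"
    by (cases rule: peel_step.cases) auto
  have vX: "v \<in> X" using v by (simp add: is_arg_min_def)
  have YY': "density H Y \<le> density H Y'" using Y' by simp
  then have kYY': "?k * density H Y \<le> ?k * density H Y'" by (simp add: mult_left_mono)
  have "U \<subseteq> X' \<or> density H U \<le> ?k * density H Y'"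
  proof (cases "U \<subseteq> X \<and> v \<in> U")
    case True
    have "finite X" using step.IH swamp_instanceD(1)[OF H] finite_subset by blast
    then have "density H U \<le> ?k * density H X"
      using True v max U by (intro densest_le_density_at_first_removal) auto
    \<comment> \<open>The set \<open>X\<close> was already compared with \<open>Y\<close> before
      \<open>v\<close> is removed.\<close>
    also have "\<dots> \<le> ?k * density H Y"
      using step.IH vX by (intro mult_left_mono) auto
    finally show ?thesis using kYY' by linarith
  next
    case False
    then show ?thesis using step.IH kYY' X' by auto
  qed
  then show ?case
    using step.IH X' Y' by auto
qed

lemma peeling_output_approx:
  assumes ne: "nodes H \<noteq> {}" and Y: "peeling_output H s Y"
  shows "Y \<noteq> {} \<and> Y \<subseteq> nodes H \<and>
    (\<forall>U. U \<subseteq> nodes H \<and> U \<noteq> {} \<longrightarrow> density H U \<le> real (max_edge_size H) * density H Y)"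
proof -
  let ?D = "{W. W \<subseteq> nodes H \<and> W \<noteq> {}}"
  have D: "finite ?D" "?D \<noteq> {}"
    using swamp_instanceD(1)[OF H] ne by auto
  then have "Max (density H ` ?D) \<in> density H ` ?D"
    by (intro Max_in) auto
  then obtain U where "U \<subseteq> nodes H" "U \<noteq> {}" and U: "Max (density H ` ?D) = density H U"
    by blast
  have max: "density H W \<le> density H U" if "W \<subseteq> nodes H" "W \<noteq> {}" for W
    using that D unfolding U[symmetric] by (intro Max_ge) auto
  \<comment> \<open>In the final state the remaining set is empty and cannot contain the nonempty
    \<open>U\<close>, so the second disjunct of the invariant holds.\<close>
  with \<open>U \<subseteq> nodes H\<close> \<open>U \<noteq> {}\<close>
    peeling_invariant[OF _ max ne Y[unfolded peeling_output_def]]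
  show ?thesis
    by (meson order_trans subset_empty)
qed

end

section \<open>Instantiating the inverse factor: \<open>1 / \<alpha>\<close> for a general
  subroutine, the maximum hyperedge size for peeling\<close>

theorem theorem7:
  fixes H :: "('v, 'e) swamp" and l :: nat
  assumes "swamp_instance H" and "1 \<le> l" and "l \<le> card (nodes H)"
  shows
    "(\<forall>(\<alpha>::real) (A :: ('v, 'e) swamp \<Rightarrow> 'v set).
        0 < \<alpha> \<and> swamp_approx \<alpha> A \<longrightarrow> card_swamp_approx (\<alpha> / (\<alpha> + 1)) A H l) \<and>
     (\<forall>s :: ('v, 'e) swamp \<Rightarrow> 'e \<Rightarrow> nat \<Rightarrow> real.
        (\<forall>G. swamp_instance G \<longrightarrow> bound_functions (absorb_weights G) (s G)) \<longrightarrow>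
        (\<forall>G. swamp_instance G \<and> nodes G \<noteq> {} \<longrightarrow>
           (\<exists>Y. peeling_output (absorb_weights G) (s G) Y)) \<and>
        (\<forall>A :: ('v, 'e) swamp \<Rightarrow> 'v set.
           (\<forall>G. swamp_instance G \<and> nodes G \<noteq> {} \<longrightarrow>
              peeling_output (absorb_weights G) (s G) (A G)) \<longrightarrow>
           card_swamp_approx (1 / (real (max_edge_size H) + 1)) A H l))"
proof (intro conjI allI impI)
  fix \<alpha> :: real and A :: "('v, 'e) swamp \<Rightarrow> 'v set"
  assume \<alpha>: "0 < \<alpha> \<and> swamp_approx \<alpha> A"
  have "A G \<noteq> {} \<and> A G \<subseteq> nodes G \<and>
      (\<forall>U. U \<subseteq> nodes G \<and> U \<noteq> {} \<longrightarrow> density G U \<le> 1 / \<alpha> * density G (A G))"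
    if G: "swamp_instance G" "nodes G \<noteq> {}" for G
  proof -
    let ?M = "Max (density G ` {U. U \<subseteq> nodes G \<and> U \<noteq> {}})"
    have A: "A G \<noteq> {}" "A G \<subseteq> nodes G" "\<alpha> * ?M \<le> density G (A G)"
      using \<alpha> G by (auto simp: swamp_approx_def)
    have "?M \<le> 1 / \<alpha> * density G (A G)"
      using A(3) \<alpha> by (simp add: field_simps)
    moreover have "density G U \<le> ?M" if "U \<subseteq> nodes G" "U \<noteq> {}" for U
      using that swamp_instanceD(1)[OF G(1)] by (intro Max_ge) auto
    ultimately show ?thesis
      using A(1,2) order_trans by blast
  qed
  then have "card_swamp_approx (1 / (1 / \<alpha> + 1)) A H l"
    using assms \<alpha> by (intro card_swamp_approx_if_swamp_approx) auto
  moreover have "1 / (1 / \<alpha> + 1) = \<alpha> / (\<alpha> + 1)"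
    using \<alpha> by (simp add: field_simps)
  ultimately show "card_swamp_approx (\<alpha> / (\<alpha> + 1)) A H l" by simp
next
  fix s :: "('v, 'e) swamp \<Rightarrow> 'e \<Rightarrow> nat \<Rightarrow> real" and G :: "('v, 'e) swamp"
  assume "swamp_instance G \<and> nodes G \<noteq> {}"
  then show "\<exists>Y. peeling_output (absorb_weights G) (s G) Y"
    unfolding peeling_output_def by (simp add: peel_terminates swamp_instanceD(1))
next
  fix s :: "('v, 'e) swamp \<Rightarrow> 'e \<Rightarrow> nat \<Rightarrow> real" and A :: "('v, 'e) swamp \<Rightarrow> 'v set"
  assume s: "\<forall>G. swamp_instance G \<longrightarrow> bound_functions (absorb_weights G) (s G)"
    and A: "\<forall>G. swamp_instance G \<and> nodes G \<noteq> {} \<longrightarrow>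
      peeling_output (absorb_weights G) (s G) (A G)"
  show "card_swamp_approx (1 / (real (max_edge_size H) + 1)) A H l"
  proof (rule card_swamp_approx_if_swamp_approx[OF assms])
    fix G :: "('v, 'e) swamp"
    assume G: "swamp_instance G" "nodes G \<noteq> {}" "max_edge_size G \<le> max_edge_size H"
    have "A G \<noteq> {} \<and> A G \<subseteq> nodes G \<and>
        (\<forall>U. U \<subseteq> nodes G \<and> U \<noteq> {} \<longrightarrow> density G U \<le> max_edge_size G * density G (A G))"
      using peeling_output_approx[OF swamp_instance_absorb_weights[OF G(1)], of "s G" "A G"]
        s A G by simp
    \<comment> \<open>The factor for \<open>G\<close> is relaxed to that of \<open>H\<close>, giving
      one constant valid in all rounds.\<close>
    moreover have "max_edge_size G * density G (A G) \<le> max_edge_size H * density G (A G)"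
      using G(3) density_nonneg[OF G(1)] by (intro mult_right_mono) auto
    ultimately show "A G \<noteq> {} \<and> A G \<subseteq> nodes G \<and>
        (\<forall>U. U \<subseteq> nodes G \<and> U \<noteq> {} \<longrightarrow> density G U \<le> max_edge_size H * density G (A G))"
      using order_trans by blast
  qed simp
qed

end
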